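(* Let $G$ be a graph with $n$ vertices. The time complexity (number of graph edges followed by the algorithm) of Algorithm UGB, whose pseudocode is given in the context, is $O(|Gr_G|\cdot n)$, where $|Gr_G|$ is the number of elements of the Graver basis of the toric ideal $I_G$. Here $O(f(n))$ denotes functions of $n$ bounded above by $c f(n)$, for some constant $c>0$ and all $n>n_0$, for some constant $n_0$.
   Context: Let $G$ be a connected, undirected, finite, simple graph with vertex set $\{v_1,\dots,v_n\}$ and edge set $\{e_1,\dots,e_m\}$, and let $\mathbb{K}$ be a field. Regard $v_i$ as the $i$-th standard basis vector of $\mathbb{Z}^n$ and associate to each edge $e=\{v_i,v_j\}$ the vector $a_e=v_i+v_j$. The toric ideal $I_G\subseteq\mathbb{K}[e_1,\dots,e_m]$ (edges as variables) is generated by all binomials $\mathbf{e}^{\mathbf{u}}-\mathbf{e}^{\mathbf{v}}$, $\mathbf{u},\mathbf{v}\in\mathbb{N}^m$, with $\sum_k u_k a_{e_k}=\sum_k v_k a_{e_k}$. An irreducible binomial $\mathbf{e}^{\mathbf{u}}-\mathbf{e}^{\mathbf{v}}\in I_G$ is primitive if there is no other binomial $\mathbf{e}^{\mathbf{w}}-\mathbf{e}^{\mathbf{z}}\in I_G$ such that $\mathbf{e}^{\mathbf{w}}$ divides $\mathbf{e}^{\mathbf{u}}$ and $\mathbf{e}^{\mathbf{z}}$ divides $\mathbf{e}^{\mathbf{v}}$. The Graver basis $Gr_G$ is the set of primitive binomials of $I_G$. The universal Gröbner basis $\mathcal{U}_G$ is the union of all reduced Gröbner bases of $I_G$ over all term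 orders. A walk is a finite sequence of edges $(\{v_{i_1},v_{i_2}\},\{v_{i_2},v_{i_3}\},\dots,\{v_{i_s},v_{i_{s+1}}\})$ of $G$ (repetitions allowed); it is closed if $v_{i_{s+1}}=v_{i_1}$ and even if $s$ is even. For an even closed walk $w=(e_{i_1},\dots,e_{i_{2q}})$ put $B_w=\prod_{k=1}^q e_{i_{2k-1}}-\prod_{k=1}^q e_{i_{2k}}\in I_G$; writing the same walk in a different way changes $B_w$ at most by sign. The elements of $Gr_G$ are of the form $B_w$, and $w$ is called primitive when $B_w$ is primitive. For a primitive walk $w$, $\mathbf{w}^+=\{e_{i_j}: j \text{ odd}\}$ and $\mathbf{w}^-=\{e_{i_j}: j\text{ even}\}$ are disjoint sets of edges. For $s\in\{+,-\}$, $(V(\mathbf{w}^s),E(\mathbf{w}^s))$ is the (not necessarily induced) simple subgraph of $G$ formed by the edges in $\mathbf{w}^s$, each appearing once regardless of multiplicity, together with their vertices; $\deg$ below is the degree in this subgraph. ALGORITHM UGB. INPUT: the elements $B_w\in Gr_G$, each split into its two parts $B_w^+$ and $B_w^-$, given as the simple subgraphs $(V(\mathbf{w}^+),E(\mathbf{w}^+))$ and $(V(\mathbf{w}^-),E(\mathbf{w}^-))$ of $G$. OUTPUT: the elements of the universal Gröbner basis $\mathcal{U}_G$. LOCAL VARIABLES: Visited, a $1\times n$ array of boolean false used in the cycle finding process; stop, a boolean; $i,j$ integers; $U$, a set of graph edges (non-ordered pairs of vertices). 1. begin algorithm 2. $\mathcal{U}_G\leftarrow\emptyset$ 3. for all elements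 $B_w\in Gr_G$ 4. — stop $\leftarrow$ false 5. — for $s\in\{+,-\}$ 6. — — Initialize Visited to false 7. — — while $\exists i\in V(\mathbf{w}^s)$ such that $\deg(v_i)=2$ and Visited[$i$] = false and stop = false 8. — — — Visited[$i$] $\leftarrow$ true 9. — — — $U\leftarrow\emptyset$ 10. — — — repeat 11. — — — — Select $j$, such that $\{v_i,v_j\}\notin U$ and $\{v_i,v_j\}\in E(\mathbf{w}^s)$ 12. — — — — $U\leftarrow U\cup\{v_i,v_j\}$ 13. — — — — if Visited[$j$] = true 14. — — — — — stop $\leftarrow$ true 15. — — — until stop = true or $\deg(v_j)=1$ 16. — — — if $\deg(v_j)=1$ (no cycle was encountered during this iteration) 17. — — — — $E(\mathbf{w}^s)\leftarrow E(\mathbf{w}^s)-U$ (delete encountered edges, updating vertices' degrees) 18. — — end while (of line 7) 19. — end for (of line 5) 20. — if stop = false 21. — — $\mathcal{U}_G\leftarrow\mathcal{U}_G\cup B_w$ 22. end for (of line 3) 23. return $\mathcal{U}_G$ 24. end algorithm Description of operation accompanying the pseudocode: the loop at lines 7–18 selects, at each iteration, an as yet unvisited vertex of degree two, if it exists, and attempts to build a cycle starting from it; the loop at lines 10–15 repeatedly selects consecutive edges until either a cycle is found or a vertex of degree one is encountered; in the latter case the encountered edges in $U$ are discarded and the cycle detection starts again at line 7. *)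

theory Defs
  imports "HOL-Library.Poly_Mapping" "HOL-Algebra.Ideal" "HOL-Algebra.Ring_Divisibility"
begin

section \<open>Graphs\<close>

text \<open>The vertices of a graph with \<open>n\<close> vertices are \<open>1, \<dots>, n\<close>; an edge is an unordered pair of
  distinct vertices, and the graph is given by \<open>n\<close> and its set of edges.\<close>

type_synonym edge = "nat set"

definition simple_graph :: "nat \<Rightarrow> edge set \<Rightarrow> bool" where
  "simple_graph n E \<longleftrightarrow> (\<forall>e\<in>E. \<exists>u\<in>{1..n}. \<exists>v\<in>{1..n}. u \<noteq> v \<and> e = {u, v})"

definition connected_graph :: "nat \<Rightarrow> edge set \<Rightarrow> bool" where
  "connected_graph n E \<longleftrightarrow> (\<forall>u\<in>{1..n}. \<forall>v\<in>{1..n}. (u, v) \<in> {(x, y). {x, y} \<in> E}\<^sup>*)"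

definition edge_degree :: "edge set \<Rightarrow> nat \<Rightarrow> nat" where
  "edge_degree D i = card {e \<in> D. i \<in> e}"

text \<open>A walk is a sequence of edges; \<open>vs\<close> is a sequence of vertices that it runs through.\<close>

definition even_closed_walk :: "edge set \<Rightarrow> edge list \<Rightarrow> bool" where
  "even_closed_walk E w \<longleftrightarrow> w \<noteq> [] \<and> even (length w) \<and>
     (\<exists>vs. length vs = Suc (length w) \<and> vs ! length w = vs ! 0 \<and>
        (\<forall>k<length w. w ! k = {vs ! k, vs ! Suc k} \<and> w ! k \<in> E))"


section \<open>The toric ideal of a graph and its Graver basis\<close>

type_synonym monom = "edge \<Rightarrow>\<^sub>0 nat"

type_synonym 'k mpoly = "monom \<Rightarrow>\<^sub>0 'k"

text \<open>The polynomial ring over the field \<open>'k\<close> whose variables are the elements of \<open>E\<close>.\<close>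

definition edge_ring :: "edge set \<Rightarrow> 'k::field mpoly ring" where
  "edge_ring E =
     \<lparr>carrier = {p. \<forall>m\<in>Poly_Mapping.keys p. Poly_Mapping.keys m \<subseteq> E},
      mult = (*), one = 1, zero = 0, add = (+)\<rparr>"

definition monomial :: "monom \<Rightarrow> 'k::field mpoly" where
  "monomial u = Poly_Mapping.single u 1"

definition monomials :: "edge set \<Rightarrow> monom set" where
  "monomials E = {u. Poly_Mapping.keys u \<subseteq> E}"

text \<open>The vector \<open>a\<^sub>e = v\<^sub>i + v\<^sub>j\<close> of an edge \<open>e = {v\<^sub>i, v\<^sub>j}\<close>; the coordinates with index outside
  \<open>{1..n}\<close> are always \<open>0\<close>.\<close>

definition edge_vec :: "edge \<Rightarrow> nat \<Rightarrow> int" where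
  "edge_vec e = (\<lambda>i. if i \<in> e then 1 else 0)"

definition vertex_degree :: "edge set \<Rightarrow> monom \<Rightarrow> nat \<Rightarrow> int" where
  "vertex_degree E u = (\<lambda>i. \<Sum>e\<in>E. int (Poly_Mapping.lookup u e) * edge_vec e i)"

definition toric_ideal :: "edge set \<Rightarrow> 'k::field mpoly set" where
  "toric_ideal E = Idl\<^bsub>edge_ring E\<^esub> {monomial u - monomial v | u v.
     u \<in> monomials E \<and> v \<in> monomials E \<and> vertex_degree E u = vertex_degree E v}"

text \<open>A binomial is a difference of two distinct monomials, so that \<open>0\<close> is not one of the other
  binomials in the definition of primitivity. The Graver basis contains every primitive binomial
  together with its negative.\<close>

definition primitive_binomial :: "edge set \<Rightarrow> 'k::field mpoly \<Rightarrow> bool" where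
  "primitive_binomial E p \<longleftrightarrow>
     (\<exists>u\<in>monomials E. \<exists>v\<in>monomials E. u \<noteq> v \<and> p = monomial u - monomial v \<and>
        p \<in> toric_ideal E \<and> ring_irreducible\<^bsub>edge_ring E\<^esub> p \<and>
        \<not> (\<exists>w\<in>monomials E. \<exists>z\<in>monomials E. w \<noteq> z \<and>
             (monomial w - monomial z :: 'k mpoly) \<in> toric_ideal E \<and>
             (monomial w - monomial z :: 'k mpoly) \<noteq> p \<and>
             (monomial w :: 'k mpoly) divides\<^bsub>edge_ring E\<^esub> monomial u \<and>
             (monomial z :: 'k mpoly) divides\<^bsub>edge_ring E\<^esub> monomial v))"

definition graver_basis :: "edge set \<Rightarrow> 'k::field mpoly set" where
  "graver_basis E = {p. primitive_binomial E p}"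

text \<open>List positions start at \<open>0\<close>, so the edges at odd positions \<open>1, 3, \<dots>\<close> of the walk, which form
  its positive part, are those with an even list index.\<close>

definition edge_var :: "edge \<Rightarrow> 'k::field mpoly" where
  "edge_var e = monomial (Poly_Mapping.single e 1)"

definition walk_binomial :: "edge list \<Rightarrow> 'k::field mpoly" where
  "walk_binomial w = (\<Prod>k<length w div 2. edge_var (w ! (2 * k)))
                   - (\<Prod>k<length w div 2. edge_var (w ! (2 * k + 1)))"

datatype sign = Plus | Minus

fun walk_part :: "edge list \<Rightarrow> sign \<Rightarrow> edge set" where
  "walk_part w Plus = {w ! k | k. k < length w \<and> even k}"
| "walk_part w Minus = {w ! k | k. k < length w \<and> odd k}"


section \<open>The algorithm\<close>

text \<open>
  The algorithm is a small-step transition system that counts the edges followed: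

  begin
    UGB := {};
    for all elements B of the Graver basis, B the binomial of the walk w
      stop := false;
      for s in {Plus, Minus}
        Visited := false everywhere;
        while there is i in V(w^s) with deg(i) = 2, not Visited[i] and not stop
          Visited[i] := true;  U := {};
          repeat
            select j such that {i,j} is in E(w^s) and not in U;
            U := U + {i,j};
            if Visited[j] then stop := true
          until stop or deg(j) = 1;    -- otherwise go on from j, i.e. i := j
          if deg(j) = 1 then E(w^s) := E(w^s) - U
        end while
      end for
      if not stop then UGB := UGB + B
    end for;
    return UGB
  end

  All choices (the order of the two outer loops, the walk \<open>w\<close> that represents an element, the
  vertex \<open>i\<close>, the neighbour \<open>j\<close>) are nondeterministic. The vertex from which the next edge is
  selected is the endpoint of the previous one, so that consecutive edges are followed; \<open>Visited\<close>
  is set only at the vertices from which a search starts. The set \<open>V(w^s)\<close> is fixed while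
  degrees are taken in the current edge set.\<close>

datatype location = For_Elements | For_Parts | While_Loop | Repeat_Loop | After_Repeat | Finished

record (overloaded) 'k ugb_state =
  location :: location
  todo :: "'k mpoly set"        \<comment> \<open>elements the outermost loop has not yet treated\<close>
  result :: "'k mpoly set"      \<comment> \<open>the set that is returned in the end\<close>
  walk :: "edge list"
  parts_todo :: "sign set"
  part_vertices :: "nat set"
  part_edges :: "edge set"
  visited :: "nat \<Rightarrow> bool"
  stop :: bool
  cur_i :: nat
  cur_j :: nat
  encountered :: "edge set"     \<comment> \<open>the local variable \<open>U\<close>\<close>
  followed :: nat               \<comment> \<open>number of edges followed so far\<close>

inductive ugb_step :: "edge set \<Rightarrow> 'k::field ugb_state \<Rightarrow> 'k ugb_state \<Rightarrow> bool" for E where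
  next_element:
    "\<lbrakk>location \<sigma> = For_Elements; even_closed_walk E w; walk_binomial w \<in> todo \<sigma>\<rbrakk> \<Longrightarrow>
     ugb_step E \<sigma> (\<sigma>\<lparr>location := For_Parts, todo := todo \<sigma> - {walk_binomial w}, walk := w,
                    stop := False, parts_todo := {Plus, Minus}\<rparr>)"
| next_part:
    "\<lbrakk>location \<sigma> = For_Parts; s \<in> parts_todo \<sigma>\<rbrakk> \<Longrightarrow>
     ugb_step E \<sigma> (\<sigma>\<lparr>location := While_Loop, parts_todo := parts_todo \<sigma> - {s},
                    part_vertices := \<Union>(walk_part (walk \<sigma>) s),
                    part_edges := walk_part (walk \<sigma>) s,
                    visited := (\<lambda>_. False)\<rparr>)"
| start_search:
    "\<lbrakk>location \<sigma> = While_Loop; i \<in> part_vertices \<sigma>; edge_degree (part_edges \<sigma>) i = 2;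
      \<not> visited \<sigma> i; \<not> stop \<sigma>\<rbrakk> \<Longrightarrow>
     ugb_step E \<sigma> (\<sigma>\<lparr>location := Repeat_Loop, visited := (visited \<sigma>)(i := True),
                    encountered := {}, cur_i := i\<rparr>)"
| end_while:
    "\<lbrakk>location \<sigma> = While_Loop;
      \<not> (\<exists>i\<in>part_vertices \<sigma>. edge_degree (part_edges \<sigma>) i = 2 \<and> \<not> visited \<sigma> i \<and> \<not> stop \<sigma>)\<rbrakk> \<Longrightarrow>
     ugb_step E \<sigma> (\<sigma>\<lparr>location := For_Parts\<rparr>)"
| follow_edge:
    "\<lbrakk>location \<sigma> = Repeat_Loop; {cur_i \<sigma>, j} \<notin> encountered \<sigma>; {cur_i \<sigma>, j} \<in> part_edges \<sigma>;
      stop' \<longleftrightarrow> stop \<sigma> \<or> visited \<sigma> j\<rbrakk> \<Longrightarrow>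
     ugb_step E \<sigma> (\<sigma>\<lparr>location := (if stop' \<or> edge_degree (part_edges \<sigma>) j = 1
                                 then After_Repeat else Repeat_Loop),
                    encountered := encountered \<sigma> \<union> {{cur_i \<sigma>, j}},
                    stop := stop', cur_i := j, cur_j := j, followed := followed \<sigma> + 1\<rparr>)"
| end_repeat:
    "location \<sigma> = After_Repeat \<Longrightarrow>
     ugb_step E \<sigma> (\<sigma>\<lparr>location := While_Loop,
                    part_edges := (if edge_degree (part_edges \<sigma>) (cur_j \<sigma>) = 1
                                   then part_edges \<sigma> - encountered \<sigma> else part_edges \<sigma>)\<rparr>)"
| end_parts:
    "\<lbrakk>location \<sigma> = For_Parts; parts_todo \<sigma> = {}\<rbrakk> \<Longrightarrow>
     ugb_step E \<sigma> (\<sigma>\<lparr>location := For_Elements,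
                    result := (if stop \<sigma> then result \<sigma>
                               else result \<sigma> \<union> {walk_binomial (walk \<sigma>)})\<rparr>)"
| end_elements:
    "\<lbrakk>location \<sigma> = For_Elements; todo \<sigma> = {}\<rbrakk> \<Longrightarrow> ugb_step E \<sigma> (\<sigma>\<lparr>location := Finished\<rparr>)"

definition ugb_initial :: "edge set \<Rightarrow> 'k::field ugb_state \<Rightarrow> bool" where
  "ugb_initial E \<sigma> \<longleftrightarrow> location \<sigma> = For_Elements \<and> todo \<sigma> = graver_basis E \<and>
     result \<sigma> = {} \<and> followed \<sigma> = 0"

text \<open>The states that occur in some execution on the graph with edge set \<open>E\<close>. Final as well as
  intermediate states are included, so a bound on \<open>followed\<close> for all of them bounds the running
  time of every execution without presupposing that it terminates.\<close>

definition ugb_reachable :: "edge set \<Rightarrow> 'k::field ugb_state \<Rightarrow> bool" where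
  "ugb_reachable E \<sigma> \<longleftrightarrow> (\<exists>\<sigma>\<^sub>0. ugb_initial E \<sigma>\<^sub>0 \<and> (ugb_step E)\<^sup>*\<^sup>* \<sigma>\<^sub>0 \<sigma>)"

end

theory Submission
  imports Defs
begin

text \<open>
  A bound with the constant \<open>2\<close> holds, for three reasons.

  First, one element of the Graver basis costs at most as many edges as its walk is long. In a part
  of a walk every search follows pairwise different edges; when it ends, it has either reached a vertex
  of degree one, and then the edges followed are deleted, or set \<open>stop\<close>, and then no further search
  starts for this element. Hence no edge of a part is followed twice. This is the invariant
  \<open>within_budget\<close>, preserved by each step (\<open>ugb_step_within_budget\<close>).

  Second, the walk of a primitive binomial has length at most \<open>2 * n\<close>
  (\<open>length_primitive_walk_le\<close>): if it came to the same vertex twice at positions of equal parity, the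
  section between the two visits would be an even closed walk of its own. Its binomial divides that of
  the whole walk term by term, and it is not zero because the two monomials of a primitive binomial are
  coprime (\<open>graver_basis_coprime\<close>); this contradicts primitivity. So each vertex occurs at most once among the even positions and at most once among
  the odd ones.

  Third, the Graver basis is finite (\<open>finite_graver_basis\<close>), so that its cardinality really counts
  the passes of the outermost loop. Pairs of exponents of different primitive binomials are
  incomparable, and by Dickson's lemma (\<open>dickson_subseq\<close>) there are only finitely many of them.
\<close>

section \<open>Binomials\<close>

text \<open>The divisibility order on exponents.\<close>

definition exponent_le :: "monom \<Rightarrow> monom \<Rightarrow> bool" where
  "exponent_le u v \<longleftrightarrow> (\<forall>e. Poly_Mapping.lookup u e \<le> Poly_Mapping.lookup v e)"

lemma exponent_le_antisym: "exponent_le u v \<Longrightarrow> exponent_le v u \<Longrightarrow> u = v"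
  unfolding exponent_le_def by (intro poly_mapping_eqI antisym) auto

lemma monomials_exponent_le:
  assumes "exponent_le u v" "v \<in> monomials E"
  shows "u \<in> monomials E"
proof -
  have "Poly_Mapping.keys u \<subseteq> Poly_Mapping.keys v"
  proof
    fix e assume "e \<in> Poly_Mapping.keys u"
    then have "0 < Poly_Mapping.lookup u e" by (simp add: in_keys_iff)
    also have "\<dots> \<le> Poly_Mapping.lookup v e" using assms(1) by (simp add: exponent_le_def)
    finally show "e \<in> Poly_Mapping.keys v" by (simp add: in_keys_iff)
  qed
  then show ?thesis using assms(2) by (auto simp: monomials_def)
qed

lemma monomial_add: "monomial (u + v) = monomial u * monomial v"
  by (simp add: monomial_def mult_single)

lemma monomial_divides:
  assumes "exponent_le u v" "v \<in> monomials E"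
  shows "(monomial u :: 'k::field mpoly) divides\<^bsub>edge_ring E\<^esub> monomial v"
proof -
  have sum: "v = u + (v - u)"
    using assms(1) by (intro poly_mapping_eqI) (simp add: exponent_le_def lookup_add lookup_minus)
  have "exponent_le (v - u) v"
    by (simp add: exponent_le_def lookup_minus)
  then have "v - u \<in> monomials E" using assms(2) by (rule monomials_exponent_le)
  then have "(monomial (v - u) :: 'k mpoly) \<in> carrier (edge_ring E)"
    by (simp add: edge_ring_def monomial_def monomials_def)
  moreover have "(monomial v :: 'k mpoly) = monomial u * monomial (v - u)"
    by (subst sum) (rule monomial_add)
  ultimately show ?thesis
    by (auto simp: factor_def edge_ring_def)
qed

lemma binomial_in_toric_ideal:
  assumes "u \<in> monomials E" "v \<in> monomials E" "vertex_degree E u = vertex_degree E v"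
  shows "monomial u - monomial v \<in> toric_ideal E"
  using assms unfolding toric_ideal_def genideal_def by blast

text \<open>Both alternatives are possible over a field of characteristic two.\<close>

lemma binomial_eqD:
  assumes eq: "(monomial u - monomial v :: 'k::field mpoly) = monomial w - monomial z"
    and "u \<noteq> v" "w \<noteq> z"
  shows "(u = w \<and> v = z) \<or> (u = z \<and> v = w)"
proof -
  have lk: "(1 when u = x) - (1 when v = x) = ((1 when w = x) - (1 when z = x) :: 'k)" for x
    using arg_cong[OF eq, of "\<lambda>p. Poly_Mapping.lookup p x"]
    by (simp add: monomial_def lookup_minus lookup_single)
  show ?thesis
    using lk[of u] lk[of v] assms(2,3) by (auto simp: when_def split: if_splits)
qed

lemma binomial_neq_0:
  assumes "u \<noteq> v"
  shows "(monomial u - monomial v :: 'k::field mpoly) \<noteq> 0"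
proof
  assume "(monomial u - monomial v :: 'k mpoly) = 0"
  then have "Poly_Mapping.lookup (monomial u - monomial v :: 'k mpoly) u = 0" by simp
  with assms show False by (simp add: monomial_def lookup_minus lookup_single)
qed

text \<open>Divisibility in \<open>edge_ring E\<close> is replaced here by the order on exponents, under which primitive
  pairs are minimal among the pairs of distinct exponents whose binomial lies in the toric ideal.\<close>

lemma graver_basis_exponents:
  assumes "(p :: 'k::field mpoly) \<in> graver_basis E"
  shows "\<exists>u v. u \<in> monomials E \<and> v \<in> monomials E \<and> u \<noteq> v \<and> p = monomial u - monomial v \<and>
    p \<in> toric_ideal E \<and>
    (\<forall>a b. exponent_le a u \<longrightarrow> exponent_le b v \<longrightarrow> a \<noteq> b \<longrightarrow>
       (monomial a - monomial b :: 'k mpoly) \<in> toric_ideal E \<longrightarrow> monomial a - monomial b = p)"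
proof -
  have "primitive_binomial E p" using assms by (simp add: graver_basis_def)
  then obtain u v where uv: "u \<in> monomials E" "v \<in> monomials E" "u \<noteq> v"
      "p = monomial u - monomial v" "p \<in> toric_ideal E"
    and least: "\<not> (\<exists>w\<in>monomials E. \<exists>z\<in>monomials E. w \<noteq> z \<and>
             (monomial w - monomial z :: 'k mpoly) \<in> toric_ideal E \<and>
             (monomial w - monomial z :: 'k mpoly) \<noteq> p \<and>
             (monomial w :: 'k mpoly) divides\<^bsub>edge_ring E\<^esub> monomial u \<and>
             (monomial z :: 'k mpoly) divides\<^bsub>edge_ring E\<^esub> monomial v)"
    unfolding primitive_binomial_def by (elim bexE conjE)
  have min: "monomial a - monomial b = p"
    if "exponent_le a u" "exponent_le b v" "a \<noteq> b"
      "(monomial a - monomial b :: 'k mpoly) \<in> toric_ideal E" for a b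
  proof (rule ccontr)
    assume neq: "monomial a - monomial b \<noteq> p"
    show False
      by (rule notE[OF least], intro bexI[of _ a] bexI[of _ b] conjI that neq
          monomials_exponent_le[OF that(1) uv(1)] monomials_exponent_le[OF that(2) uv(2)]
          monomial_divides[OF that(1) uv(1)] monomial_divides[OF that(2) uv(2)])
  qed
  show ?thesis
    by (rule exI[of _ u], rule exI[of _ v], intro conjI allI impI uv, rule min)
qed

text \<open>The form in which primitivity is applied to walks. It holds for every way of writing the binomial as
  a difference of monomials; in characteristic two, the order of \<open>u\<close> and \<open>v\<close> here need not be the one
  that witnesses primitivity.\<close>

lemma graver_basis_minimal:
  assumes p: "(monomial u - monomial v :: 'k::field mpoly) \<in> graver_basis E"
    and wu: "exponent_le w u" and zv: "exponent_le z v" and "w \<noteq> z"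
    and deg: "vertex_degree E w = vertex_degree E z"
  shows "w = u \<and> z = v"
proof -
  from graver_basis_exponents[OF p] obtain u' v'
    where uv': "u' \<in> monomials E" "v' \<in> monomials E" "u' \<noteq> v'"
    and eq: "(monomial u - monomial v :: 'k mpoly) = monomial u' - monomial v'"
    and least: "\<And>a b. \<lbrakk>exponent_le a u'; exponent_le b v'; a \<noteq> b;
        (monomial a - monomial b :: 'k mpoly) \<in> toric_ideal E\<rbrakk>
        \<Longrightarrow> (monomial a - monomial b :: 'k mpoly) = monomial u' - monomial v'"
    by metis
  have "u \<noteq> v" using eq binomial_neq_0[OF uv'(3), where 'k = 'k] by auto
  have min: "(a = u' \<and> b = v') \<or> (a = v' \<and> b = u')"
    if "exponent_le a u'" "exponent_le b v'" "a \<noteq> b" "vertex_degree E a = vertex_degree E b" for a b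
  proof -
    have "(monomial a - monomial b :: 'k mpoly) \<in> toric_ideal E"
      using that uv' by (intro binomial_in_toric_ideal) (auto intro: monomials_exponent_le)
    with that show ?thesis using binomial_eqD[OF least \<open>a \<noteq> b\<close> uv'(3)] by blast
  qed
  from binomial_eqD[OF eq \<open>u \<noteq> v\<close> uv'(3)] show ?thesis
  proof
    assume "u = u' \<and> v = v'"
    then show ?thesis using min[of w z] wu zv \<open>w \<noteq> z\<close> deg exponent_le_antisym by metis
  next
    assume "u = v' \<and> v = u'"
    then show ?thesis using min[of z w] wu zv \<open>w \<noteq> z\<close> deg exponent_le_antisym by metis
  qed
qed


section \<open>Finiteness of the Graver basis\<close>

lemma nat_seq_mono_subseq:
  fixes f :: "nat \<Rightarrow> nat"
  obtains r :: "nat \<Rightarrow> nat" where "strict_mono r" "mono (\<lambda>k. f (r k))"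
proof -
  obtain r where r: "strict_mono r" and m: "monoseq (\<lambda>k. f (r k))"
    using seq_monosub by blast
  show ?thesis
  proof (cases "mono (\<lambda>k. f (r k))")
    case True
    then show ?thesis by (rule that[OF r])
  next
    case False
    then have dec: "f (r l) \<le> f (r k)" if "k \<le> l" for k l
      using m that unfolding monoseq_def mono_def by blast
    obtain k0 where k0: "\<And>k. f (r k0) \<le> f (r k)"
      using ex_has_least_nat[of "\<lambda>_. True" 0 "\<lambda>k. f (r k)"] by auto
    (* a decreasing sequence is constant from the position of its minimum on *)
    have "f (r (k0 + k)) = f (r k0)" for k
      using k0[of "k0 + k"] dec[of k0 "k0 + k"] by simp
    then have "mono (\<lambda>k. f (r (k0 + k)))" by (simp add: mono_def)
    moreover have "strict_mono (\<lambda>k. r (k0 + k))"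
      using r by (simp add: strict_mono_def)
    ultimately show ?thesis by (intro that)
  qed
qed

text \<open>Dickson's lemma, for sequences: the induction needs a subsequence that is weakly increasing in all
  coordinates, not just two comparable members.\<close>

lemma dickson_subseq:
  fixes f :: "nat \<Rightarrow> 'a \<Rightarrow> nat"
  assumes "finite A"
  shows "\<exists>r :: nat \<Rightarrow> nat. strict_mono r \<and> (\<forall>a\<in>A. mono (\<lambda>k. f (r k) a))"
  using assms
proof (induction A)
  case empty
  show ?case by (intro exI[of _ "id :: nat \<Rightarrow> nat"]) (simp add: strict_mono_def)
next
  case (insert a A)
  then obtain r :: "nat \<Rightarrow> nat" where r: "strict_mono r" "\<And>b. b \<in> A \<Longrightarrow> mono (\<lambda>k. f (r k) b)" by blast
  obtain t :: "nat \<Rightarrow> nat" where t: "strict_mono t" "mono (\<lambda>k. f (r (t k)) a)"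
    using nat_seq_mono_subseq[of "\<lambda>k. f (r k) a"] by blast
  have "mono (\<lambda>k. f (r (t k)) b)" if "b \<in> A" for b
    using r(2)[OF that] strict_mono_mono[OF t(1)] by (simp add: mono_def)
  moreover have "strict_mono (\<lambda>k. r (t k))"
    using r(1) t(1) by (simp add: strict_mono_def)
  ultimately show ?case using t(2) by (intro exI[of _ "\<lambda>k. r (t k)"]) auto
qed

lemma exponent_leI_monomials:
  assumes "u \<in> monomials E" "\<And>e. e \<in> E \<Longrightarrow> Poly_Mapping.lookup u e \<le> Poly_Mapping.lookup v e"
  shows "exponent_le u v"
  unfolding exponent_le_def
proof
  fix e
  show "Poly_Mapping.lookup u e \<le> Poly_Mapping.lookup v e"
  proof (cases "e \<in> E")
    case False
    then have "Poly_Mapping.lookup u e = 0" using assms(1) by (auto simp: monomials_def in_keys_iff)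
    then show ?thesis by simp
  qed (use assms in blast)
qed

lemma finite_graver_basis:
  assumes "finite E"
  shows "finite (graver_basis E :: 'k::field mpoly set)"
proof (rule ccontr)
  assume "infinite (graver_basis E :: 'k mpoly set)"
  then obtain g :: "nat \<Rightarrow> 'k mpoly" where inj: "inj g" and g: "range g \<subseteq> graver_basis E"
    using infinite_countable_subset by blast
  then have "g k \<in> graver_basis E" for k by blast
  then have "\<forall>k. \<exists>u v. u \<in> monomials E \<and> v \<in> monomials E \<and> u \<noteq> v \<and> g k = monomial u - monomial v \<and>
      g k \<in> toric_ideal E \<and>
      (\<forall>a b. exponent_le a u \<longrightarrow> exponent_le b v \<longrightarrow> a \<noteq> b \<longrightarrow>
         (monomial a - monomial b :: 'k mpoly) \<in> toric_ideal E \<longrightarrow> monomial a - monomial b = g k)"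
    using graver_basis_exponents by blast
  then obtain u v where uv: "\<And>k. u k \<in> monomials E" "\<And>k. v k \<in> monomials E" "\<And>k. u k \<noteq> v k"
      "\<And>k. g k = monomial (u k) - monomial (v k)" "\<And>k. g k \<in> toric_ideal E"
    and least: "\<And>k a b. \<lbrakk>exponent_le a (u k); exponent_le b (v k); a \<noteq> b;
        (monomial a - monomial b :: 'k mpoly) \<in> toric_ideal E\<rbrakk> \<Longrightarrow> monomial a - monomial b = g k"
    by metis
  (* both exponents as one point with coordinates in E times bool *)
  define f where "f k = (\<lambda>(e, plus). Poly_Mapping.lookup (if plus then u k else v k) e)"
    for k :: nat
  obtain r :: "nat \<Rightarrow> nat" where r: "strict_mono r" and mono: "\<forall>a\<in>E \<times> UNIV. mono (\<lambda>k. f (r k) a)"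
    using dickson_subseq[of "E \<times> (UNIV :: bool set)" f] assms by auto
  have "f (r 0) (e, plus) \<le> f (r 1) (e, plus)" if "e \<in> E" for e plus
    using mono that by (auto simp: mono_def)
  from this[of _ True] this[of _ False]
  have "exponent_le (u (r 0)) (u (r 1))" "exponent_le (v (r 0)) (v (r 1))"
    by (auto intro!: exponent_leI_monomials[OF uv(1)] exponent_leI_monomials[OF uv(2)]
        simp: f_def)
  then have "g (r 0) = g (r 1)"
    using least[of "u (r 0)" "r 1" "v (r 0)"] uv(3-5)[of "r 0"] by simp
  then have "r 0 = r 1" using inj by (simp add: inj_def)
  then show False using r by (metis strict_mono_eq zero_neq_one)
qed


section \<open>Walks of primitive binomials\<close>

text \<open>The exponent of the product of the edges of a walk at the positions in a set.\<close>

definition walk_exponent :: "edge list \<Rightarrow> nat set \<Rightarrow> monom" where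
  "walk_exponent w K = (\<Sum>k\<in>K. Poly_Mapping.single (w ! k) 1)"

lemma lookup_walk_exponent:
  "finite K \<Longrightarrow> Poly_Mapping.lookup (walk_exponent w K) e = card {k \<in> K. w ! k = e}"
  by (simp add: walk_exponent_def lookup_sum lookup_single when_def sum.If_cases Int_def)

lemma exponent_le_walk_exponent:
  assumes "finite K" "L \<subseteq> K"
  shows "exponent_le (walk_exponent w L) (walk_exponent w K)"
  using assms finite_subset[OF assms(2,1)]
  by (auto simp: exponent_le_def lookup_walk_exponent intro!: card_mono)

lemma walk_exponent_psubset:
  assumes "finite K" "L \<subset> K"
  shows "walk_exponent w L \<noteq> walk_exponent w K"
proof -
  obtain k where k: "k \<in> K" "k \<notin> L" using assms(2) by blast
  have "{l \<in> L. w ! l = w ! k} \<subset> {l \<in> K. w ! l = w ! k}" using k assms(2) by blast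
  then have "card {l \<in> L. w ! l = w ! k} < card {l \<in> K. w ! l = w ! k}"
    using assms(1) by (intro psubset_card_mono) auto
  then have "Poly_Mapping.lookup (walk_exponent w L) (w ! k)
      \<noteq> Poly_Mapping.lookup (walk_exponent w K) (w ! k)"
    using assms finite_subset[of L K] by (simp add: lookup_walk_exponent psubset_eq)
  then show ?thesis by metis
qed

lemma monomial_sum: "finite A \<Longrightarrow> monomial (\<Sum>x\<in>A. f x) = (\<Prod>x\<in>A. monomial (f x))"
  by (induction A rule: finite_induct) (simp_all add: monomial_add, simp add: monomial_def)

lemma walk_binomial_eq:
  assumes "even (length w)"
  shows "(walk_binomial w :: 'k::field mpoly) = monomial (walk_exponent w {k. k < length w \<and> even k})
                         - monomial (walk_exponent w {k. k < length w \<and> odd k})"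
proof -
  have "bij_betw (\<lambda>k. 2 * k) {..<length w div 2} {k. k < length w \<and> even k}"
    using assms by (intro bij_betwI[of _ _ _ "\<lambda>k. k div 2"]) auto
  then have even: "(\<Prod>k<length w div 2. edge_var (w ! (2 * k)))
      = (\<Prod>k\<in>{k. k < length w \<and> even k}. edge_var (w ! k) :: 'k mpoly)"
    by (rule prod.reindex_bij_betw)
  have "bij_betw (\<lambda>k. 2 * k + 1) {..<length w div 2} {k. k < length w \<and> odd k}"
    using assms by (intro bij_betwI[of _ _ _ "\<lambda>k. k div 2"]) (auto elim!: evenE, presburger)
  then have odd: "(\<Prod>k<length w div 2. edge_var (w ! (2 * k + 1)))
      = (\<Prod>k\<in>{k. k < length w \<and> odd k}. edge_var (w ! k) :: 'k mpoly)"
    by (rule prod.reindex_bij_betw)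
  show ?thesis
    unfolding walk_binomial_def even odd walk_exponent_def
    by (simp add: monomial_sum edge_var_def)
qed

lemma vertex_degree_walk_exponent:
  assumes "finite E" "finite K" "\<And>k. k \<in> K \<Longrightarrow> w ! k \<in> E"
  shows "vertex_degree E (walk_exponent w K) x = (\<Sum>k\<in>K. edge_vec (w ! k) x)"
proof -
  have "vertex_degree E (walk_exponent w K) x
      = (\<Sum>e\<in>E. \<Sum>k\<in>K. if w ! k = e then edge_vec e x else 0)"
    unfolding vertex_degree_def walk_exponent_def
    by (simp add: lookup_sum lookup_single when_def sum_distrib_right if_distrib cong: if_cong)
      (intro sum.cong refl, auto)
  also have "\<dots> = (\<Sum>k\<in>K. \<Sum>e\<in>E. if w ! k = e then edge_vec e x else 0)"
    by (rule sum.swap)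
  also have "\<dots> = (\<Sum>k\<in>K. edge_vec (w ! k) x)"
    using assms by (intro sum.cong refl) (simp add: sum.delta)
  finally show ?thesis .
qed

text \<open>The alternating sum of the edge vectors along a walk telescopes. So on a section of even
  length between two visits of the same vertex, the edges at even positions and those at odd
  positions cover each vertex equally often.\<close>

lemma alternating_edge_vec_sum:
  assumes "i \<le> j" "\<And>k. i \<le> k \<Longrightarrow> k < j \<Longrightarrow> w ! k = {p k, p (Suc k)} \<and> p k \<noteq> p (Suc k)"
  shows "(\<Sum>k=i..<j. (-1) ^ k * edge_vec (w ! k) x)
       = (-1) ^ i * edge_vec {p i} x - (-1) ^ j * edge_vec {p j} x"
  using assms
proof (induction j rule: dec_induct)
  case base
  show ?case by simp
next
  case (step j)
  have "edge_vec (w ! j) x = edge_vec {p j} x + edge_vec {p (Suc j)} x"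
    using step.prems[of j] step.hyps by (auto simp: edge_vec_def)
  then show ?case using step by (simp add: algebra_simps)
qed

lemma vertex_degree_closed_section:
  assumes "finite E" "i \<le> j" "even i = even j" "p i = p j"
    and w: "\<And>k. i \<le> k \<Longrightarrow> k < j \<Longrightarrow> w ! k = {p k, p (Suc k)} \<and> p k \<noteq> p (Suc k) \<and> w ! k \<in> E"
  shows "vertex_degree E (walk_exponent w {k. i \<le> k \<and> k < j \<and> even k})
       = vertex_degree E (walk_exponent w {k. i \<le> k \<and> k < j \<and> odd k})"
proof
  fix x
  let ?P = "{k. i \<le> k \<and> k < j \<and> even k}" and ?M = "{k. i \<le> k \<and> k < j \<and> odd k}"
  have in_E: "w ! k \<in> E" if "i \<le> k" "k < j" for k
    using w[OF that] by blast
  have deg: "vertex_degree E (walk_exponent w ?P) x = (\<Sum>k\<in>?P. edge_vec (w ! k) x)"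
    "vertex_degree E (walk_exponent w ?M) x = (\<Sum>k\<in>?M. edge_vec (w ! k) x)"
    by (rule vertex_degree_walk_exponent[OF assms(1)]; simp add: in_E)+
  have "(-1 :: int) ^ i = (-1) ^ j" using assms(3) by (simp add: minus_one_power_iff)
  then have "0 = (\<Sum>k=i..<j. (-1) ^ k * edge_vec (w ! k) x)"
    using alternating_edge_vec_sum[of i j w p x] assms by simp
  also have "{i..<j} = ?P \<union> ?M" by auto
  also have "(\<Sum>k\<in>?P \<union> ?M. (-1) ^ k * edge_vec (w ! k) x)
      = (\<Sum>k\<in>?P. (-1) ^ k * edge_vec (w ! k) x) + (\<Sum>k\<in>?M. (-1) ^ k * edge_vec (w ! k) x)"
    by (intro sum.union_disjoint) auto
  also have "\<dots> = (\<Sum>k\<in>?P. edge_vec (w ! k) x) - (\<Sum>k\<in>?M. edge_vec (w ! k) x)"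
    by (simp add: sum_negf)
  also have "\<dots> = vertex_degree E (walk_exponent w ?P) x - vertex_degree E (walk_exponent w ?M) x"
    by (simp only: deg)
  finally show "vertex_degree E (walk_exponent w ?P) x = vertex_degree E (walk_exponent w ?M) x"
    by simp
qed

text \<open>A variable common to both monomials could be cancelled.\<close>

lemma graver_basis_coprime:
  assumes "finite E" and p: "(monomial u - monomial v :: 'k::field mpoly) \<in> graver_basis E"
    and deg: "vertex_degree E u = vertex_degree E v" and "u \<noteq> v"
  shows "Poly_Mapping.lookup u e = 0 \<or> Poly_Mapping.lookup v e = 0"
proof (rule ccontr)
  assume "\<not> ?thesis"
  then have pos: "0 < Poly_Mapping.lookup u e" "0 < Poly_Mapping.lookup v e" by auto
  define u' v' where "u' = u - Poly_Mapping.single e 1" and "v' = v - Poly_Mapping.single e 1"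
  have u: "u = u' + Poly_Mapping.single e 1" and v: "v = v' + Poly_Mapping.single e 1"
    unfolding u'_def v'_def using pos
    by (auto intro!: poly_mapping_eqI simp: lookup_add lookup_minus lookup_single when_def)
  have shift: "vertex_degree E (a + Poly_Mapping.single e 1) x
      = vertex_degree E a x + vertex_degree E (Poly_Mapping.single e 1) x" for a x
    by (simp add: vertex_degree_def lookup_add algebra_simps sum.distrib)
  have "vertex_degree E u' = vertex_degree E v'"
  proof
    fix x
    show "vertex_degree E u' x = vertex_degree E v' x"
      using fun_cong[OF deg, of x] shift[of u' x] shift[of v' x]
      unfolding u[symmetric] v[symmetric] by linarith
  qed
  moreover have "exponent_le u' u" "exponent_le v' v"
    by (simp_all add: exponent_le_def u'_def v'_def lookup_minus)
  moreover have "u' \<noteq> v'" using u v \<open>u \<noteq> v\<close> by auto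
  ultimately have "u' = u" using graver_basis_minimal[OF p] by blast
  then have "Poly_Mapping.lookup u e = Poly_Mapping.lookup u e + 1"
    using arg_cong[OF u, of "\<lambda>a. Poly_Mapping.lookup a e"] by (simp add: lookup_add)
  then show False by simp
qed

lemma simple_graphD:
  assumes "simple_graph n E" "{x, y} \<in> E"
  shows "x \<in> {1..n}" "y \<in> {1..n}" "x \<noteq> y"
proof -
  obtain a b where "a \<in> {1..n}" "b \<in> {1..n}" "a \<noteq> b" "{x, y} = {a, b}"
    using assms unfolding simple_graph_def by blast
  then show "x \<in> {1..n}" "y \<in> {1..n}" "x \<noteq> y" by (auto simp: doubleton_eq_iff)
qed

lemma finite_simple_graph: "simple_graph n E \<Longrightarrow> finite E"
  by (rule finite_subset[of E "Pow {1..n}"]) (auto simp: simple_graph_def)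

lemma length_primitive_walk_le:
  assumes "simple_graph n E" and "even_closed_walk E w"
    and gr: "(walk_binomial w :: 'k::field mpoly) \<in> graver_basis E"
  shows "length w \<le> 2 * n"
proof -
  let ?P = "\<lambda>i j. {k. i \<le> k \<and> k < j \<and> even k}" and ?M = "\<lambda>i j. {k. i \<le> k \<and> k < j \<and> odd k}"
  have fin: "finite E" using assms(1) by (rule finite_simple_graph)
  from assms(2) obtain vs where len: "w \<noteq> []" "even (length w)"
    and closed: "vs ! length w = vs ! 0"
    and vs: "\<And>k. k < length w \<Longrightarrow> w ! k = {vs ! k, vs ! Suc k} \<and> w ! k \<in> E"
    unfolding even_closed_walk_def by blast
  have vs': "vs ! k \<in> {1..n}" "vs ! k \<noteq> vs ! Suc k" if "k < length w" for k
    using simple_graphD[OF assms(1), of "vs ! k" "vs ! Suc k"] vs[OF that] by auto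
  define u v where "u = walk_exponent w (?P 0 (length w))" and "v = walk_exponent w (?M 0 (length w))"
  have B: "(monomial u - monomial v :: 'k mpoly) \<in> graver_basis E"
    using gr unfolding walk_binomial_eq[OF len(2)] by (simp add: u_def v_def)
  have sect: "vertex_degree E (walk_exponent w (?P i j)) = vertex_degree E (walk_exponent w (?M i j))"
    if "i \<le> j" "j \<le> length w" "even i = even j" "vs ! i = vs ! j" for i j
  proof (rule vertex_degree_closed_section[where p = "\<lambda>k. vs ! k"])
    fix k assume "k < j"
    then have k: "k < length w" using that by simp
    show "w ! k = {vs ! k, vs ! Suc k} \<and> vs ! k \<noteq> vs ! Suc k \<and> w ! k \<in> E"
      using vs[OF k] vs'(2)[OF k] by blast
  qed (use that fin in auto)
  have deg: "vertex_degree E u = vertex_degree E v"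
    unfolding u_def v_def using sect[of 0 "length w"] len closed by simp
  have "u \<noteq> v"
  proof
    assume "u = v"
    then have "(0 :: 'k mpoly) \<in> graver_basis E" using B by simp
    then show False using graver_basis_exponents binomial_neq_0 by metis
  qed
  have no_revisit: False if ij: "i < j" "j < length w" "even i = even j" "vs ! i = vs ! j" for i j
  proof -
    define a b where "a = walk_exponent w (?P i j)" and "b = walk_exponent w (?M i j)"
    have le: "exponent_le a u" "exponent_le b v"
      unfolding a_def b_def u_def v_def using ij by (auto intro!: exponent_le_walk_exponent)
    (* by equal parity, the position after i is still in the section *)
    have "(if even i then i else Suc i) \<in> ?P i j" using ij by (cases "Suc i = j") auto
    then obtain k where k: "k \<in> ?P i j" by blast
    then have "0 < Poly_Mapping.lookup a (w ! k)"
      by (auto simp: a_def lookup_walk_exponent card_gt_0_iff)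
    then have "a \<noteq> b"
      using le graver_basis_coprime[OF fin B deg \<open>u \<noteq> v\<close>, of "w ! k"]
      unfolding exponent_le_def by (metis le_zero_eq less_numeral_extra(3))
    then have "b = v"
      using graver_basis_minimal[OF B le] sect[of i j] ij by (simp add: a_def b_def)
    (* the last position of the walk is odd and lies outside the section *)
    moreover have "length w - 1 \<in> ?M 0 (length w) - ?M i j" using ij len by auto
    moreover have "?M i j \<subseteq> ?M 0 (length w)" using ij(2) by auto
    ultimately have "b = v" "?M i j \<subset> ?M 0 (length w)" by blast+
    then show False
      unfolding b_def v_def using walk_exponent_psubset[of "?M 0 (length w)" "?M i j" w] by simp
  qed
  have "inj_on (\<lambda>k. (vs ! k, even k)) {..<length w}"
    using no_revisit by (intro linorder_inj_onI) auto
  moreover have "(\<lambda>k. (vs ! k, even k)) ` {..<length w} \<subseteq> {1..n} \<times> UNIV" using vs' by auto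
  ultimately have "card {..<length w} \<le> card ({1..n} \<times> (UNIV :: bool set))"
    by (intro card_inj_on_le) auto
  then show ?thesis by simp
qed

lemma finite_walk_part [simp]: "finite (walk_part w s)"
  by (cases s) auto

lemma card_walk_parts_le: "card (walk_part w Plus) + card (walk_part w Minus) \<le> length w"
proof -
  let ?P = "{k. k < length w \<and> even k}" and ?M = "{k. k < length w \<and> odd k}"
  have "walk_part w Plus = (!) w ` ?P" "walk_part w Minus = (!) w ` ?M" by auto
  then have "card (walk_part w Plus) + card (walk_part w Minus) \<le> card ?P + card ?M"
    by (simp add: add_mono card_image_le)
  also have "\<dots> = card (?P \<union> ?M)" by (intro card_Un_disjoint[symmetric]) auto
  also have "?P \<union> ?M = {..<length w}" by auto
  finally show ?thesis by simp
qed


section \<open>Counting the edges followed\<close>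

text \<open>The number of edges that can still be followed in the current part. In the while loop none is
  left once \<open>stop\<close> is set.\<close>

definition part_budget :: "'k::field ugb_state \<Rightarrow> nat" where
  "part_budget \<sigma> = (case location \<sigma> of
     While_Loop \<Rightarrow> if stop \<sigma> then 0 else card (part_edges \<sigma>)
   | Repeat_Loop \<Rightarrow> card (part_edges \<sigma> - encountered \<sigma>)
   | After_Repeat \<Rightarrow> card (part_edges \<sigma> - encountered \<sigma>)
   | _ \<Rightarrow> 0)"

text \<open>The number of edges in the parts of the current element that have not yet been searched. Outside
  the loop over the parts the state carries no current element.\<close>

definition element_budget :: "'k::field ugb_state \<Rightarrow> nat" where
  "element_budget \<sigma> = (if location \<sigma> \<in> {For_Elements, Finished} then 0
     else \<Sum>s\<in>parts_todo \<sigma>. card (walk_part (walk \<sigma>) s))"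

text \<open>The invariant. Each element not yet treated is allotted \<open>2 * n\<close> edges.
  The clause about \<open>After_Repeat\<close> says that a search that did not set \<open>stop\<close> ended at a vertex of degree
  one, so that its edges are about to be deleted. Components that the initial state leaves arbitrary are
  constrained only at locations that are reached after they have been set.\<close>

definition within_budget :: "nat \<Rightarrow> edge set \<Rightarrow> 'k::field ugb_state \<Rightarrow> bool" where
  "within_budget n E \<sigma> \<longleftrightarrow>
     todo \<sigma> \<subseteq> graver_basis E \<and>
     (location \<sigma> \<notin> {For_Elements, Finished} \<longrightarrow> finite (parts_todo \<sigma>)) \<and>
     (location \<sigma> \<in> {While_Loop, Repeat_Loop, After_Repeat} \<longrightarrow> finite (part_edges \<sigma>)) \<and>
     (location \<sigma> = After_Repeat \<longrightarrow>
        stop \<sigma> \<or> edge_degree (part_edges \<sigma>) (cur_j \<sigma>) = 1) \<and>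
     followed \<sigma> + part_budget \<sigma> + element_budget \<sigma> + 2 * n * card (todo \<sigma>)
       \<le> 2 * n * card (graver_basis E :: 'k mpoly set)"

lemma ugb_step_within_budget:
  fixes \<sigma> :: "'k::field ugb_state"
  assumes G: "simple_graph n E" and "ugb_step E \<sigma> \<sigma>'" and inv: "within_budget n E \<sigma>"
  shows "within_budget n E \<sigma>'"
  using assms(2)
proof cases
  case (next_element w)
  have todo: "todo \<sigma> \<subseteq> graver_basis E" using inv by (simp add: within_budget_def)
  then have "finite (todo \<sigma>)"
    using finite_graver_basis[OF finite_simple_graph[OF G]] by (rule finite_subset)
  then have "card (todo \<sigma>) = Suc (card (todo \<sigma> - {walk_binomial w}))"
    using next_element by (intro card.remove) auto
  then have "2 * n * card (todo \<sigma>) = 2 * n + 2 * n * card (todo \<sigma> - {walk_binomial w})"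
    by (simp only: mult_Suc_right)
  moreover have "length w \<le> 2 * n"
    using length_primitive_walk_le[OF G] next_element todo by blast
  then have "card (walk_part w Plus) + card (walk_part w Minus) \<le> 2 * n"
    using card_walk_parts_le[of w] by linarith
  ultimately show ?thesis
    using inv next_element
    by (auto simp: within_budget_def part_budget_def element_budget_def
        simp del: walk_part.simps card_Diff_singleton)
next
  case (next_part s)
  then have "(\<Sum>t\<in>parts_todo \<sigma>. card (walk_part (walk \<sigma>) t))
      = card (walk_part (walk \<sigma>) s) + (\<Sum>t\<in>parts_todo \<sigma> - {s}. card (walk_part (walk \<sigma>) t))"
    using inv by (intro sum.remove) (auto simp: within_budget_def)
  then show ?thesis
    using inv next_part by (auto simp: within_budget_def part_budget_def element_budget_def)
next
  case (follow_edge j stop')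
  (* the edge followed is new, so it uses up one unit of the budget *)
  have "card (part_edges \<sigma> - insert {cur_i \<sigma>, j} (encountered \<sigma>))
      < card (part_edges \<sigma> - encountered \<sigma>)"
    using inv follow_edge by (intro psubset_card_mono) (auto simp: within_budget_def)
  then show ?thesis
    using inv follow_edge by (auto simp: within_budget_def part_budget_def element_budget_def)
qed (use inv in \<open>auto simp: within_budget_def part_budget_def element_budget_def split: if_splits\<close>)

lemma ugb_reachable_within_budget:
  fixes \<sigma> :: "'k::field ugb_state"
  assumes "simple_graph n E" "ugb_reachable E \<sigma>"
  shows "within_budget n E \<sigma>"
proof -
  obtain \<sigma>\<^sub>0 where init: "ugb_initial E \<sigma>\<^sub>0" and steps: "(ugb_step E)\<^sup>*\<^sup>* \<sigma>\<^sub>0 \<sigma>"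
    using assms(2) unfolding ugb_reachable_def by blast
  from steps show ?thesis
  proof induction
    case base
    show ?case
      using init by (simp add: ugb_initial_def within_budget_def part_budget_def element_budget_def)
  next
    case (step \<sigma>' \<sigma>'')
    then show ?case using ugb_step_within_budget[OF assms(1)] by blast
  qed
qed

theorem corollary3p5:
  "\<exists>c::real. c > 0 \<and> (\<exists>n\<^sub>0::nat. \<forall>n>n\<^sub>0. \<forall>E.
     simple_graph n E \<longrightarrow> connected_graph n E \<longrightarrow>
     (\<forall>\<sigma> :: 'k::field ugb_state. ugb_reachable E \<sigma> \<longrightarrow>
        real (followed \<sigma>) \<le> c * (real (card (graver_basis E :: 'k mpoly set)) * real n)))"
proof (intro exI[of _ "2::real"] exI[of _ "0::nat"] conjI allI impI)
  fix n :: nat and E :: "edge set" and \<sigma> :: "'k ugb_state"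
  assume "simple_graph n E" "ugb_reachable E \<sigma>"
  then have "followed \<sigma> \<le> 2 * n * card (graver_basis E :: 'k mpoly set)"
    using ugb_reachable_within_budget[of n E \<sigma>] by (simp add: within_budget_def)
  then have "real (followed \<sigma>) \<le> real (2 * n * card (graver_basis E :: 'k mpoly set))"
    by (rule of_nat_mono)
  then show "real (followed \<sigma>) \<le> 2 * (real (card (graver_basis E :: 'k mpoly set)) * real n)"
    by (simp add: mult.commute mult.left_commute)
qed simp

end
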